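(* Let $R$ be a ring with unit, let $e$ be an idempotent of $R$, and let $R_e=\{x\in R: ex=x=xe\}$. Then $R_e$ is a ring with unit $e$ under the multiplication and addition of $R$, and the interval $e\!\downarrow$ of the orthomodular poset $E(R)$ is equal to the orthomodular poset $E(R_e)$ (same underlying set, same partial order, same orthocomplementation).
   Context: An orthocomplemented poset is a bounded poset $P$ with a unary operation $'$ that is of period two ($x''=x$), order inverting, and such that for each $x$ the only lower bound of $x,x'$ is $0$ and the only upper bound of $x,x'$ is $1$. An orthomodular poset (OMP) is an orthocomplemented poset such that (1) $x\leq y'$ implies $x,y$ have a least upper bound, written $x\oplus y$; and (2) $x\leq y$ implies $x\oplus(x\oplus y')'=y$. For a ring $S$ with unit $1_S$ (not necessarily commutative), $E(S)$ denotes the set of idempotents of $S$, with $f\leq g$ iff $fg=f=gf$, and $f'=1_S-f$. It is known that $E(S)$ is an OMP. For an element $p$ of an OMP $P$, the interval $p\!\downarrow=\{q\in P: q\leq p\}$ is an OMP under the induced partial order and the orthocomplementation $q^{\#}=p\wedge q'$ (this greatest lower bound exists in $P$). *)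

theory Defs
  imports "HOL-Algebra.Lattice" "HOL-Algebra.Ring"
begin

record 'a orthoposet = "'a gorder" +
  ocompl :: "'a \<Rightarrow> 'a"

text \<open>A bounded poset with an order-inverting unary operation of period two under which
  \<^term>\<open>x\<close> and its complement have only the trivial lower and upper bounds. The degenerate case
  \<open>\<bottom> = \<top>\<close> is allowed: it occurs for the idempotents of the zero ring.\<close>

locale orthocomplemented_poset =
  partial_order P + weak_partial_order_bottom P + weak_partial_order_top P
  for P :: "('a, 'm) orthoposet_scheme" (structure) +
  assumes ocompl_closed: "x \<in> carrier P \<Longrightarrow> ocompl P x \<in> carrier P"
    and ocompl_ocompl: "x \<in> carrier P \<Longrightarrow> ocompl P (ocompl P x) = x"
    and ocompl_antimono:
      "\<lbrakk>x \<in> carrier P; y \<in> carrier P; x \<sqsubseteq> y\<rbrakk> \<Longrightarrow> ocompl P y \<sqsubseteq> ocompl P x"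
    and Lower_ocompl: "x \<in> carrier P \<Longrightarrow> Lower P {x, ocompl P x} = {\<bottom>}"
    and Upper_ocompl: "x \<in> carrier P \<Longrightarrow> Upper P {x, ocompl P x} = {\<top>}"

text \<open>The join of two elements is the sum \<open>x \<oplus> y\<close> of orthogonal elements. It is a Hilbert choice
  of a least upper bound, hence meaningful only where one exists. In \<open>orthomodular_law\<close> both joins
  exist by \<open>orthogonal_join_exists\<close>.\<close>

locale orthomodular_poset = orthocomplemented_poset +
  assumes orthogonal_join_exists:
      "\<lbrakk>x \<in> carrier P; y \<in> carrier P; x \<sqsubseteq> ocompl P y\<rbrakk> \<Longrightarrow> \<exists>s. least P s (Upper P {x, y})"
    and orthomodular_law:
      "\<lbrakk>x \<in> carrier P; y \<in> carrier P; x \<sqsubseteq> y\<rbrakk>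
        \<Longrightarrow> x \<squnion> ocompl P (x \<squnion> ocompl P y) = y"

definition omp_interval ::
    "('a, 'm) orthoposet_scheme \<Rightarrow> 'a \<Rightarrow> ('a, 'm) orthoposet_scheme"
  where "omp_interval P p = P\<lparr>carrier := {q \<in> carrier P. q \<sqsubseteq>\<^bsub>P\<^esub> p},
                               ocompl := (\<lambda>q. p \<sqinter>\<^bsub>P\<^esub> ocompl P q)\<rparr>"

text \<open>The meet in \<open>omp_interval\<close> is a genuine greatest lower bound.\<close>

lemma (in orthomodular_poset) interval_ocompl_is_glb:
  assumes "p \<in> carrier P" "q \<in> carrier (omp_interval P p)"
  shows "greatest P (ocompl (omp_interval P p) q) (Lower P {p, ocompl P q})"
proof -
  have q: "q \<in> carrier P" "q \<sqsubseteq> p"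
    using assms(2) by (auto simp: omp_interval_def)
  have "q \<sqsubseteq> ocompl P (ocompl P p)"
    using q assms(1) by (simp add: ocompl_ocompl)
  then obtain s where s: "least P s (Upper P {q, ocompl P p})"
    using orthogonal_join_exists q(1) ocompl_closed[OF assms(1)] by blast
  have sc: "s \<in> carrier P" and qs: "q \<sqsubseteq> s" and ps: "ocompl P p \<sqsubseteq> s"
    and s_le: "\<And>u. \<lbrakk>u \<in> carrier P; q \<sqsubseteq> u; ocompl P p \<sqsubseteq> u\<rbrakk> \<Longrightarrow> s \<sqsubseteq> u"
    using s q(1) ocompl_closed[OF assms(1)] by (auto simp: least_def Upper_def)
  have "ocompl P s \<sqsubseteq> p"
    using ocompl_antimono[OF _ _ ps] sc assms(1) by (simp add: ocompl_closed ocompl_ocompl)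
  moreover have "ocompl P s \<sqsubseteq> ocompl P q"
    using ocompl_antimono[OF _ _ qs] sc q(1) by simp
  moreover have "l \<sqsubseteq> ocompl P s"
    if l: "l \<in> carrier P" "l \<sqsubseteq> p" "l \<sqsubseteq> ocompl P q" for l
  proof -
    have "q \<sqsubseteq> ocompl P l"
      using ocompl_antimono[OF _ _ l(3)] l(1) q(1) by (simp add: ocompl_closed ocompl_ocompl)
    moreover have "ocompl P p \<sqsubseteq> ocompl P l"
      using ocompl_antimono[OF _ _ l(2)] l(1) assms(1) by simp
    ultimately have "s \<sqsubseteq> ocompl P l"
      using s_le l(1) ocompl_closed by blast
    then show ?thesis
      using ocompl_antimono[of s "ocompl P l"] l(1) sc by (simp add: ocompl_closed ocompl_ocompl)
  qed
  ultimately have "greatest P (ocompl P s) (Lower P {p, ocompl P q})"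
    using sc q(1) assms(1) ocompl_closed by (auto simp: greatest_def Lower_def)
  then have "greatest P (p \<sqinter> ocompl P q) (Lower P {p, ocompl P q})"
    unfolding meet_def inf_def by (rule someI)
  then show ?thesis
    by (simp add: omp_interval_def)
qed

definition idempotents :: "('a, 'm) ring_scheme \<Rightarrow> 'a set"
  where "idempotents S = {f \<in> carrier S. f \<otimes>\<^bsub>S\<^esub> f = f}"

definition idempotent_poset :: "('a, 'm) ring_scheme \<Rightarrow> 'a orthoposet"
  where "idempotent_poset S =
    \<lparr>carrier = idempotents S,
     eq = (=),
     le = (\<lambda>f g. f \<otimes>\<^bsub>S\<^esub> g = f \<and> f = g \<otimes>\<^bsub>S\<^esub> f),
     ocompl = (\<lambda>f. \<one>\<^bsub>S\<^esub> \<ominus>\<^bsub>S\<^esub> f)\<rparr>"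

definition corner_ring :: "('a, 'm) ring_scheme \<Rightarrow> 'a \<Rightarrow> ('a, 'm) ring_scheme"
  where "corner_ring R e =
    R\<lparr>carrier := {x \<in> carrier R. e \<otimes>\<^bsub>R\<^esub> x = x \<and> x = x \<otimes>\<^bsub>R\<^esub> e}, one := e\<rparr>"

end

theory Submission
  imports Defs
begin

text \<open>
  Everything reduces to calculations with orthogonal idempotents. For idempotents, \<open>f \<le> 1 - g\<close>
  means \<open>f g = 0 = g f\<close>, and then \<open>f + g\<close> is again an idempotent and is the least upper bound of
  \<open>f\<close> and \<open>g\<close>, because an upper bound \<open>u\<close> absorbs \<open>f\<close> and \<open>g\<close> and hence, by distributivity, their
  sum. If \<open>f \<le> g\<close>, this turns the orthomodular law into \<open>f + (1 - (f + (1 - g))) = g\<close>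
  (\<open>ring.orthomodular_idempotent_poset\<close>).

  The condition that puts an idempotent \<open>f\<close> into the corner ring, \<open>e f = f = f e\<close>, is literally
  \<open>f \<le> e\<close>, and the corner inherits the multiplication; so the underlying sets and the orders agree.
  The complement of \<open>f\<close> in the corner is \<open>e - f\<close>, while in the interval it is the meet of \<open>e\<close> and
  \<open>1 - f\<close>. These coincide since \<open>e - f\<close> is a lower bound of both and, for any other lower bound \<open>x\<close>, \<open>x \<le> e\<close> and
  \<open>x f = 0 = f x\<close> force \<open>x (e - f) = x = (e - f) x\<close>
  (\<open>ring.meet_idempotent_compl\<close>). The corner being a ring, its idempotents form an orthomodular
  poset, and the agreement carries this over to the interval.
\<close>

section \<open>Complements in an orthomodular poset\<close>

text \<open>Two orthocomplementations that agree on the carrier can still be different functions on the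
  whole type. This lemma bridges that gap between the interval and the corner.\<close>

lemma orthomodular_poset_ocompl_cong:
  fixes P :: "('a, 'm) orthoposet_scheme" (structure)
  assumes "orthomodular_poset P"
    and c: "\<And>x. x \<in> carrier P \<Longrightarrow> c x = ocompl P x"
  shows "orthomodular_poset (P\<lparr>ocompl := c\<rparr>)"
proof -
  interpret orthomodular_poset P by fact
  let ?Q = "P\<lparr>ocompl := c\<rparr>"
  have order: "Upper ?Q = Upper P" "Lower ?Q = Lower P" "least ?Q = least P"
    "greatest ?Q = greatest P"
    by (auto simp: fun_eq_iff Upper_def Lower_def least_def greatest_def)
  have join: "join ?Q = join P"
    by (simp add: fun_eq_iff join_def sup_def order)
  have ends: "bottom ?Q = bottom P" "top ?Q = top P"
    by (simp_all add: bottom_def top_def least_def greatest_def Upper_def Lower_def)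
  \<comment> \<open>The inner join of the orthomodular law must lie in the carrier, since only there does \<open>c\<close>
    take the value of the complement.\<close>
  have join_closed: "x \<squnion> y \<in> carrier P"
    if "x \<in> carrier P" "y \<in> carrier P" "x \<sqsubseteq> ocompl P y" for x y
    using someI_ex[OF orthogonal_join_exists[OF that]] least_closed
    unfolding join_def sup_def by auto
  show ?thesis
  proof
    fix x y assume xy: "x \<in> carrier ?Q" "y \<in> carrier ?Q" "x \<sqsubseteq>\<^bsub>?Q\<^esub> y"
    then have "x \<squnion> ocompl P y \<in> carrier P"
      by (intro join_closed) (auto simp: ocompl_closed ocompl_ocompl)
    then show "x \<squnion>\<^bsub>?Q\<^esub> ocompl ?Q (x \<squnion>\<^bsub>?Q\<^esub> ocompl ?Q y) = y"
      using xy by (simp add: join c orthomodular_law)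
  qed (use bottom_exists top_exists in \<open>simp_all add: order ends c eq_is_equal ocompl_closed
        ocompl_ocompl Lower_ocompl Upper_ocompl ocompl_antimono orthogonal_join_exists,
        (blast intro: le_antisym le_trans)+\<close>)
qed

section \<open>The orthomodular poset of idempotents\<close>

context ring
begin

lemma r_minus_distr:
  "\<lbrakk>x \<in> carrier R; y \<in> carrier R; z \<in> carrier R\<rbrakk> \<Longrightarrow> x \<otimes> (y \<ominus> z) = x \<otimes> y \<ominus> x \<otimes> z"
  by (simp add: minus_eq r_distr r_minus)

lemma l_minus_distr:
  "\<lbrakk>x \<in> carrier R; y \<in> carrier R; z \<in> carrier R\<rbrakk> \<Longrightarrow> (y \<ominus> z) \<otimes> x = y \<otimes> x \<ominus> z \<otimes> x"
  by (simp add: minus_eq l_distr l_minus)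

lemma minus_eq_self_iff:
  assumes "x \<in> carrier R" "y \<in> carrier R"
  shows "x \<ominus> y = x \<longleftrightarrow> y = \<zero>"
  using assms by (simp add: minus_eq add.r_cancel_one add.inv_eq_1_iff)

lemma minus_self: "x \<in> carrier R \<Longrightarrow> x \<ominus> x = \<zero>"
  by (simp add: minus_eq r_neg)

lemma minus_zero_right: "x \<in> carrier R \<Longrightarrow> x \<ominus> \<zero> = x"
  by (simp add: minus_eq)

lemma minus_minus_cancel:
  "\<lbrakk>x \<in> carrier R; y \<in> carrier R\<rbrakk> \<Longrightarrow> x \<ominus> (x \<ominus> y) = y"
  by (simp add: minus_eq minus_add r_neg2)

lemma add_minus_inverse:
  "\<lbrakk>x \<in> carrier R; y \<in> carrier R\<rbrakk> \<Longrightarrow> x \<oplus> (y \<ominus> x) = y"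
  by (simp add: minus_eq a_lcomm[of x y] r_neg)

lemma idempotentsD:
  assumes "f \<in> idempotents R"
  shows "f \<in> carrier R" "f \<otimes> f = f"
  using assms by (auto simp: idempotents_def)

lemma carrier_idempotent_poset: "carrier (idempotent_poset R) = idempotents R"
  by (simp add: idempotent_poset_def)

lemma eq_idempotent_poset: "eq (idempotent_poset R) = (=)"
  by (simp add: idempotent_poset_def)

lemma idempotent_poset_le_iff:
  "f \<sqsubseteq>\<^bsub>idempotent_poset R\<^esub> g \<longleftrightarrow> f \<otimes> g = f \<and> g \<otimes> f = f"
  by (auto simp: idempotent_poset_def)

text \<open>Expanding \<open>(g - f) (g - f)\<close> gives \<open>(g - f) - (f - f)\<close>. With \<open>g\<close> the unit this is the
  idempotence of complements, with \<open>g = e\<close> that of complements relative to \<open>e\<close>.\<close>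

lemma idempotent_minus:
  assumes "f \<in> idempotents R" "g \<in> idempotents R" "f \<otimes> g = f" "g \<otimes> f = f"
  shows "g \<ominus> f \<in> idempotents R"
  using assms
  by (simp add: idempotents_def r_minus_distr l_minus_distr) (simp add: minus_eq r_neg)

lemma one_minus_idempotent: "f \<in> idempotents R \<Longrightarrow> \<one> \<ominus> f \<in> idempotents R"
  by (rule idempotent_minus) (auto simp: idempotents_def)

lemma le_one_minus_iff_orthogonal:
  assumes "f \<in> carrier R" "g \<in> carrier R"
  shows "f \<sqsubseteq>\<^bsub>idempotent_poset R\<^esub> \<one> \<ominus> g \<longleftrightarrow> f \<otimes> g = \<zero> \<and> g \<otimes> f = \<zero>"
  using assms
  by (simp add: idempotent_poset_le_iff r_minus_distr l_minus_distr minus_eq_self_iff)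

lemma partial_order_idempotent_poset: "partial_order (idempotent_poset R)"
proof
  fix x y z
  assume "x \<in> carrier (idempotent_poset R)" "y \<in> carrier (idempotent_poset R)"
    "z \<in> carrier (idempotent_poset R)"
    and xy: "x \<sqsubseteq>\<^bsub>idempotent_poset R\<^esub> y" and yz: "y \<sqsubseteq>\<^bsub>idempotent_poset R\<^esub> z"
  then have c: "x \<in> carrier R" "y \<in> carrier R" "z \<in> carrier R"
    by (auto simp: idempotent_poset_def idempotents_def)
  have "x \<otimes> z = x \<otimes> (y \<otimes> z)" "z \<otimes> x = (z \<otimes> y) \<otimes> x"
    using xy c by (auto simp: idempotent_poset_le_iff m_assoc[symmetric]) (simp add: m_assoc)
  then show "x \<sqsubseteq>\<^bsub>idempotent_poset R\<^esub> z"
    using xy yz by (simp add: idempotent_poset_le_iff)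
qed (auto simp: eq_idempotent_poset carrier_idempotent_poset idempotent_poset_le_iff idempotentsD)

text \<open>The vanishing products make \<open>f + g\<close> an idempotent absorbing \<open>f\<close> and \<open>g\<close>; it is least because
  \<open>(f + g) u = f u + g u = f + g\<close>, and likewise on the left, for every upper bound \<open>u\<close>.\<close>

lemma least_orthogonal_sum:
  assumes f: "f \<in> idempotents R" and g: "g \<in> idempotents R"
    and "f \<otimes> g = \<zero>" "g \<otimes> f = \<zero>"
  shows "least (idempotent_poset R) (f \<oplus> g) (Upper (idempotent_poset R) {f, g})"
  using assms
  by (auto simp: least_def Upper_def idempotent_poset_le_iff carrier_idempotent_poset
      idempotents_def l_distr r_distr)

lemma join_orthogonal_idempotents:
  assumes "f \<in> idempotents R" "g \<in> idempotents R" "f \<otimes> g = \<zero>" "g \<otimes> f = \<zero>"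
  shows "f \<squnion>\<^bsub>idempotent_poset R\<^esub> g = f \<oplus> g"
proof -
  interpret partial_order "idempotent_poset R" by (rule partial_order_idempotent_poset)
  show ?thesis
    unfolding join_def sup_def
    using least_orthogonal_sum[OF assms] by (blast intro: some_equality least_unique)
qed

lemma zero_least_idempotent: "least (idempotent_poset R) \<zero> (carrier (idempotent_poset R))"
  by (auto simp: least_def carrier_idempotent_poset idempotent_poset_le_iff idempotents_def)

lemma one_greatest_idempotent: "greatest (idempotent_poset R) \<one> (carrier (idempotent_poset R))"
  by (auto simp: greatest_def carrier_idempotent_poset idempotent_poset_le_iff idempotents_def)

text \<open>The orthomodular law involves two joins, \<open>x\<close> with \<open>1 - y\<close> and \<open>x\<close> with \<open>y - x\<close>. Both pairs are
  orthogonal when \<open>x \<le> y\<close>, so both joins are sums. A common lower bound of \<open>x\<close> and \<open>1 - x\<close>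
  vanishes since it is both absorbed and annihilated by \<open>x\<close>; a common upper bound absorbs
  \<open>x + (1 - x)\<close>, hence is \<open>1\<close>.\<close>

theorem orthomodular_idempotent_poset: "orthomodular_poset (idempotent_poset R)"
proof -
  interpret P: partial_order "idempotent_poset R" by (rule partial_order_idempotent_poset)
  let ?P = "idempotent_poset R"
  note [simp] = le_one_minus_iff_orthogonal carrier_idempotent_poset
  have ocompl [simp]: "ocompl ?P = (\<lambda>f. \<one> \<ominus> f)"
    by (simp add: idempotent_poset_def)
  have bottom: "\<bottom>\<^bsub>?P\<^esub> = \<zero>"
    unfolding bottom_def using zero_least_idempotent by (blast intro: some_equality P.least_unique)
  have top: "\<top>\<^bsub>?P\<^esub> = \<one>"
    unfolding top_def using one_greatest_idempotent by (blast intro: some_equality P.greatest_unique)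
  show ?thesis
  proof
    show "\<exists>x. least ?P x (carrier ?P)" "\<exists>x. greatest ?P x (carrier ?P)"
      using zero_least_idempotent one_greatest_idempotent by blast+
  next
    fix x assume "x \<in> carrier ?P"
    then have x: "x \<in> idempotents R" "x \<in> carrier R" "x \<otimes> x = x" by (auto dest: idempotentsD)
    show "ocompl ?P x \<in> carrier ?P" using x by (simp add: one_minus_idempotent)
    show "ocompl ?P (ocompl ?P x) = x" using x by (simp add: minus_minus_cancel)
    have "z = \<zero>" if "z \<sqsubseteq>\<^bsub>?P\<^esub> x" "z \<sqsubseteq>\<^bsub>?P\<^esub> \<one> \<ominus> x" "z \<in> carrier R" for z
      using that x by (simp add: idempotent_poset_le_iff[of z x])
    then show "Lower ?P {x, ocompl ?P x} = {\<bottom>\<^bsub>?P\<^esub>}"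
      using x one_minus_idempotent zero_least_idempotent
      by (auto simp: Lower_def bottom least_def dest: idempotentsD)
    have "z = \<one>" if z: "x \<sqsubseteq>\<^bsub>?P\<^esub> z" "\<one> \<ominus> x \<sqsubseteq>\<^bsub>?P\<^esub> z" "z \<in> carrier R" for z
    proof -
      have "z = z \<otimes> (x \<oplus> (\<one> \<ominus> x))" using x z(3) by (simp add: add_minus_inverse)
      also have "\<dots> = x \<oplus> (\<one> \<ominus> x)"
        using x z by (simp only: r_distr minus_closed one_closed idempotent_poset_le_iff)
      finally show ?thesis using x by (simp add: add_minus_inverse)
    qed
    then show "Upper ?P {x, ocompl ?P x} = {\<top>\<^bsub>?P\<^esub>}"
      using x one_minus_idempotent one_greatest_idempotent
      by (auto simp: Upper_def top greatest_def dest: idempotentsD)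
  next
    fix x y assume "x \<in> carrier ?P" "y \<in> carrier ?P" and le: "x \<sqsubseteq>\<^bsub>?P\<^esub> y"
    then have x: "x \<in> idempotents R" "x \<in> carrier R" "x \<otimes> x = x"
      and y: "y \<in> idempotents R" "y \<in> carrier R" "y \<otimes> y = y" by (auto dest: idempotentsD)
    have xy: "x \<otimes> y = x" "y \<otimes> x = x" using le by (auto simp: idempotent_poset_le_iff)
    show "ocompl ?P y \<sqsubseteq>\<^bsub>?P\<^esub> ocompl ?P x"
      using x y xy by (simp add: r_minus_distr l_minus_distr) (simp add: minus_eq r_neg)
    have "x \<squnion>\<^bsub>?P\<^esub> (\<one> \<ominus> y) = x \<oplus> (\<one> \<ominus> y)"
      using x y xy
      by (intro join_orthogonal_idempotents)
        (auto simp: one_minus_idempotent r_minus_distr l_minus_distr minus_self)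
    moreover have "\<one> \<ominus> (x \<oplus> (\<one> \<ominus> y)) = y \<ominus> x"
    proof -
      have "\<one> \<ominus> (x \<oplus> (\<one> \<ominus> y)) = (\<one> \<ominus> (\<one> \<ominus> y)) \<ominus> x"
        using x y by (simp add: minus_eq minus_add a_ac)
      then show ?thesis using y by (simp add: minus_minus_cancel)
    qed
    moreover have "x \<squnion>\<^bsub>?P\<^esub> (y \<ominus> x) = x \<oplus> (y \<ominus> x)"
      using x y xy
      by (intro join_orthogonal_idempotents)
        (auto simp: idempotent_minus r_minus_distr l_minus_distr minus_self)
    ultimately show "x \<squnion>\<^bsub>?P\<^esub> ocompl ?P (x \<squnion>\<^bsub>?P\<^esub> ocompl ?P y) = y"
      using x y by (simp add: add_minus_inverse)
  next
    fix x y assume "x \<in> carrier ?P" "y \<in> carrier ?P" "x \<sqsubseteq>\<^bsub>?P\<^esub> ocompl ?P y"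
    then show "\<exists>s. least ?P s (Upper ?P {x, y})"
      using least_orthogonal_sum[of x y] by (auto simp: idempotentsD)
  qed
qed

section \<open>Corner rings and intervals\<close>

text \<open>The meet that complements \<open>f\<close> in the interval is formed in the whole poset. Its value \<open>e - f\<close> no
  longer refers to the unit of the ring and so makes sense in the corner.\<close>

lemma meet_idempotent_compl:
  assumes e: "e \<in> idempotents R" and f: "f \<in> idempotents R"
    and fe: "f \<otimes> e = f" "e \<otimes> f = f"
  shows "e \<sqinter>\<^bsub>idempotent_poset R\<^esub> (\<one> \<ominus> f) = e \<ominus> f"
proof -
  interpret P: partial_order "idempotent_poset R" by (rule partial_order_idempotent_poset)
  let ?P = "idempotent_poset R"
  note e' = idempotentsD[OF e] and f' = idempotentsD[OF f]
  have "e \<ominus> f \<sqsubseteq>\<^bsub>?P\<^esub> e"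
    using e' f' fe by (simp add: idempotent_poset_le_iff r_minus_distr l_minus_distr)
  moreover have "e \<ominus> f \<sqsubseteq>\<^bsub>?P\<^esub> \<one> \<ominus> f"
    using e' f' fe by (simp add: le_one_minus_iff_orthogonal r_minus_distr l_minus_distr)
      (simp add: minus_eq r_neg)
  moreover have "x \<sqsubseteq>\<^bsub>?P\<^esub> e \<ominus> f"
    if "x \<in> idempotents R" "x \<sqsubseteq>\<^bsub>?P\<^esub> e" "x \<sqsubseteq>\<^bsub>?P\<^esub> \<one> \<ominus> f" for x
    using that e' f' idempotentsD[OF that(1)]
    by (simp add: le_one_minus_iff_orthogonal)
      (simp add: idempotent_poset_le_iff r_minus_distr l_minus_distr minus_zero_right)
  ultimately have "greatest ?P (e \<ominus> f) (Lower ?P {e, \<one> \<ominus> f})"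
    using idempotent_minus[OF f e fe] e f one_minus_idempotent
    by (auto simp: greatest_def Lower_def carrier_idempotent_poset)
  then show ?thesis
    unfolding meet_def inf_def by (blast intro: some_equality P.greatest_unique)
qed

text \<open>Closure under each operation is two-sided absorption by \<open>e\<close>, and absorption is also what makes
  \<open>e\<close> the unit; the ring laws are inherited.\<close>

lemma ring_corner_ring:
  assumes "e \<in> idempotents R"
  shows "ring (corner_ring R e)"
proof -
  note e = idempotentsD[OF assms]
  have absorb: "e \<otimes> (x \<otimes> y) = x \<otimes> y" "x \<otimes> y \<otimes> e = x \<otimes> y"
    if "x \<in> carrier R" "y \<in> carrier R" "e \<otimes> x = x" "y \<otimes> e = y" for x y
    using that e by (simp_all add: m_assoc[symmetric]) (simp add: m_assoc)
  show ?thesis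
  proof (rule ringI)
    show "abelian_group (corner_ring R e)"
    proof (rule abelian_groupI)
      fix x assume "x \<in> carrier (corner_ring R e)"
      then show "\<exists>y\<in>carrier (corner_ring R e). y \<oplus>\<^bsub>corner_ring R e\<^esub> x = \<zero>\<^bsub>corner_ring R e\<^esub>"
        using e by (intro bexI[of _ "\<ominus> x"]) (auto simp: corner_ring_def l_neg r_minus l_minus)
    qed (use e in \<open>auto simp: corner_ring_def r_distr l_distr a_ac\<close>)
    show "monoid (corner_ring R e)"
      using e by (intro monoidI) (auto simp: corner_ring_def m_assoc absorb)
  qed (auto simp: corner_ring_def l_distr r_distr)
qed

text \<open>Additive inverses are defined relative to the carrier, so that those of the corner have to be
  identified with those of the whole ring before \<open>e - f\<close> can be read in either.\<close>

lemma minus_corner_ring: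
  assumes e: "e \<in> idempotents R"
    and y: "y \<in> carrier (corner_ring R e)"
  shows "x \<ominus>\<^bsub>corner_ring R e\<^esub> y = x \<ominus> y"
proof -
  interpret C: ring "corner_ring R e" using e by (rule ring_corner_ring)
  have "\<ominus>\<^bsub>corner_ring R e\<^esub> y = \<ominus> y"
    using y idempotentsD[OF e]
    by (intro C.minus_equality) (auto simp: corner_ring_def l_neg r_minus l_minus)
  then show ?thesis
    by (simp add: a_minus_def) (simp add: corner_ring_def)
qed

lemma carrier_interval_eq_corner:
  "carrier (omp_interval (idempotent_poset R) e)
    = carrier (idempotent_poset (corner_ring R e))"
  by (auto simp: omp_interval_def idempotent_poset_def idempotents_def corner_ring_def)

lemma le_interval_eq_corner:
  "le (omp_interval (idempotent_poset R) e) = le (idempotent_poset (corner_ring R e))"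
  by (simp add: omp_interval_def idempotent_poset_def corner_ring_def)

lemma ocompl_interval_eq_corner:
  assumes e: "e \<in> idempotents R"
    and f: "f \<in> carrier (omp_interval (idempotent_poset R) e)"
  shows "ocompl (omp_interval (idempotent_poset R) e) f
    = ocompl (idempotent_poset (corner_ring R e)) f"
proof -
  have f': "f \<in> idempotents R" "f \<otimes> e = f" "e \<otimes> f = f"
    using f by (auto simp: omp_interval_def idempotent_poset_def)
  have "ocompl (omp_interval (idempotent_poset R) e) f = e \<sqinter>\<^bsub>idempotent_poset R\<^esub> (\<one> \<ominus> f)"
    by (simp add: omp_interval_def) (simp add: idempotent_poset_def)
  also have "\<dots> = e \<ominus> f" using e f' by (rule meet_idempotent_compl)
  also have "\<dots> = e \<ominus>\<^bsub>corner_ring R e\<^esub> f"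
    using e f' idempotentsD[OF f'(1)]
    by (subst minus_corner_ring) (auto simp: corner_ring_def)
  finally show ?thesis by (simp add: idempotent_poset_def corner_ring_def)
qed

text \<open>As records, the interval and the poset of the corner differ only in the values of the
  complement outside the common carrier.\<close>

theorem orthomodular_idempotent_interval:
  assumes e: "e \<in> idempotents R"
  shows "orthomodular_poset (omp_interval (idempotent_poset R) e)"
proof -
  let ?I = "omp_interval (idempotent_poset R) e" and ?E = "idempotent_poset (corner_ring R e)"
  have "orthomodular_poset (?E\<lparr>ocompl := ocompl ?I\<rparr>)"
    using ring.orthomodular_idempotent_poset[OF ring_corner_ring[OF e]]
      carrier_interval_eq_corner[of e] ocompl_interval_eq_corner[OF e]
    by (intro orthomodular_poset_ocompl_cong) auto
  moreover have "?E\<lparr>ocompl := ocompl ?I\<rparr> = ?I"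
    using carrier_interval_eq_corner[of e] le_interval_eq_corner[of e]
    by (intro orthoposet.equality) (simp_all, simp_all add: omp_interval_def idempotent_poset_def)
  ultimately show ?thesis by simp
qed

end

theorem theorem3p2:
  fixes R :: "('a, 'm) ring_scheme" and e :: 'a
  assumes "ring R"
    and "e \<in> idempotents R"
  shows "ring (corner_ring R e)
    \<and> orthomodular_poset (idempotent_poset R)
    \<and> orthomodular_poset (omp_interval (idempotent_poset R) e)
    \<and> orthomodular_poset (idempotent_poset (corner_ring R e))
    \<and> carrier (omp_interval (idempotent_poset R) e)
        = carrier (idempotent_poset (corner_ring R e))
    \<and> (\<forall>f \<in> carrier (omp_interval (idempotent_poset R) e).
         \<forall>g \<in> carrier (omp_interval (idempotent_poset R) e).
           f \<sqsubseteq>\<^bsub>omp_interval (idempotent_poset R) e\<^esub> g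
             \<longleftrightarrow> f \<sqsubseteq>\<^bsub>idempotent_poset (corner_ring R e)\<^esub> g)
    \<and> (\<forall>f \<in> carrier (omp_interval (idempotent_poset R) e).
         ocompl (omp_interval (idempotent_poset R) e) f
           = ocompl (idempotent_poset (corner_ring R e)) f)"
proof -
  interpret ring R by fact
  interpret C: ring "corner_ring R e" using assms(2) by (rule ring_corner_ring)
  show ?thesis
    using C.ring_axioms orthomodular_idempotent_poset orthomodular_idempotent_interval[OF assms(2)]
      C.orthomodular_idempotent_poset carrier_interval_eq_corner[of e]
      le_interval_eq_corner[of e] ocompl_interval_eq_corner[OF assms(2)]
    by simp
qed

end
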